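(* Let $\mathbb{F}_q$ be a finite field. Let $W$ be a weighing matrix $\mathrm{W}(n,m)$ and let $G$ be a permutation automorphism group of $W$ acting with $t$ orbits on the rows and $t$ orbits on the columns of $W$, all of the same length. Let $B$ be the $t\times b$ point-by-block incidence matrix of an $(r,\lambda)$-design, and let $R$ be the row orbit matrix of $W$ with respect to $G$. If $r+(t-1)\lambda+m\neq 0$ and $r-\lambda+m\neq 0$ in $\mathbb{F}_q$, then $A=[\,R\mid B\,]$ (with entries interpreted in $\mathbb{F}_q$) generates an LCD code $C$ of length $t+b$ over $\mathbb{F}_q$.
   Context: A weighing matrix $\mathrm{W}(n,m)$ is an $n\times n$ matrix $W$ with entries in $\{0,1,-1\}$ such that $WW^{\top}=mI_n$ over $\mathbb{C}$. A permutation automorphism of an $n\times n$ matrix $M$ is a pair $(P,Q)$ of permutation matrices with $PMQ^{\top}=M$; these form a group $\mathrm{PAut}(M)$ under $(P,Q)(R,S)=(PR,QS)$, and a permutation automorphism group of $M$ is a subgroup $G\le\mathrm{PAut}(M)$; it acts on the rows of $M$ (via $P$) and on the columns of $M$ (via $Q$). Let $\mathcal{R}_1,\dots,\mathcal{R}_t$ and $\mathcal{C}_1,\dots,\mathcal{C}_t$ be the $G$-orbits on rows and columns, and let $M_{ij}$ be the submatrix of $M$ with rows in $\mathcal{R}_i$ and columns in $\mathcal{C}_j$. All rows of $M_{ij}$ have the same sum $\Gamma_{ij}$; the row orbit matrix of $M$ with respect to $G$ is the $t\times t$ matrix $R=[\Gamma_{ij}]$. An $(r,\lambda)$-design is a finite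 set of points with a collection of $b$ subsets (blocks) such that each point lies in exactly $r$ blocks and every pair of distinct points lies together in exactly $\lambda$ blocks; its point-by-block incidence matrix is the $(0,1)$-matrix with rows indexed by points, columns by blocks, and entry $1$ exactly when the point lies in the block. Integers are interpreted in $\mathbb{F}_q$. A matrix over $\mathbb{F}_q$ generates the linear code spanned by its rows. For a linear code $C\subseteq\mathbb{F}_q^N$, $C^\perp$ is its orthogonal complement under the standard inner product, and $C$ is LCD if $C\cap C^\perp=\{0\}$. *)

theory Defs
  imports Complex_Main "HOL-Library.Multiset" "HOL-Algebra.Group_Action"
    "Jordan_Normal_Form.VS_Connect"
begin

definition weighing_matrix :: "nat \<Rightarrow> nat \<Rightarrow> int mat \<Rightarrow> bool" where
  "weighing_matrix n m W \<longleftrightarrow>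
     W \<in> carrier_mat n n \<and>
     elements_mat W \<subseteq> {0, 1, -1} \<and>
     (let W' = map_mat complex_of_int W in W' * W'\<^sup>T = of_nat m \<cdot>\<^sub>m 1\<^sub>m n)"

definition permutation_matrix :: "nat \<Rightarrow> 'a::semiring_1 mat \<Rightarrow> bool" where
  "permutation_matrix n P \<longleftrightarrow>
     P \<in> carrier_mat n n \<and>
     elements_mat P \<subseteq> {0, 1} \<and>
     (\<forall>i<n. \<exists>!j. j < n \<and> P $$ (i, j) = 1) \<and>
     (\<forall>j<n. \<exists>!i. i < n \<and> P $$ (i, j) = 1)"

definition PAut :: "nat \<Rightarrow> 'a::semiring_1 mat \<Rightarrow> ('a mat \<times> 'a mat) monoid" where
  "PAut n M =
     \<lparr>carrier = {(P, Q). permutation_matrix n P \<and> permutation_matrix n Q \<and> P * M * Q\<^sup>T = M},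
      monoid.mult = (\<lambda>(P, Q) (R, S). (P * R, Q * S)),
      one = (1\<^sub>m n, 1\<^sub>m n)\<rparr>"

text \<open>A permutation matrix \<open>P\<close> sends the index \<open>i\<close> to the index \<open>k\<close> with
  \<open>P e\<^sub>i = e\<^sub>k\<close>, i.e. to the position of the unique \<open>1\<close> in column \<open>i\<close>.\<close>

definition perm_act :: "nat \<Rightarrow> 'a::semiring_1 mat \<Rightarrow> nat \<Rightarrow> nat" where
  "perm_act n P = (\<lambda>i\<in>{..<n}. THE k. k < n \<and> P $$ (k, i) = 1)"

definition row_orbits :: "nat \<Rightarrow> 'a::semiring_1 mat \<Rightarrow> ('a mat \<times> 'a mat) set \<Rightarrow> nat set set" where
  "row_orbits n M G = orbits (PAut n M\<lparr>carrier := G\<rparr>) {..<n} (\<lambda>(P, Q). perm_act n P)"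

definition col_orbits :: "nat \<Rightarrow> 'a::semiring_1 mat \<Rightarrow> ('a mat \<times> 'a mat) set \<Rightarrow> nat set set" where
  "col_orbits n M G = orbits (PAut n M\<lparr>carrier := G\<rparr>) {..<n} (\<lambda>(P, Q). perm_act n Q)"

text \<open>The lists \<open>Rs\<close> and \<open>Cs\<close> enumerate the row orbits and the column orbits.
  The \<open>(i, j)\<close> entry is the common value of the sums over the columns in \<open>Cs ! j\<close> of the
  rows in \<open>Rs ! i\<close>, which does not depend on the row because \<open>G\<close> permutes the columns in \<open>Cs ! j\<close>.\<close>

definition row_orbit_matrix :: "'a::semiring_1 mat \<Rightarrow> nat set list \<Rightarrow> nat set list \<Rightarrow> 'a mat" where
  "row_orbit_matrix M Rs Cs =
     mat (length Rs) (length Cs)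
       (\<lambda>(i, j). THE s. \<forall>x\<in>Rs ! i. (\<Sum>y\<in>Cs ! j. M $$ (x, y)) = s)"

text \<open>Blocks form a multiset, so repeated blocks are allowed.\<close>

definition r_lambda_design :: "'p set \<Rightarrow> 'p set multiset \<Rightarrow> nat \<Rightarrow> nat \<Rightarrow> bool" where
  "r_lambda_design V \<B> r lam \<longleftrightarrow>
     finite V \<and>
     (\<forall>X\<in>#\<B>. X \<subseteq> V) \<and>
     (\<forall>x\<in>V. size {#X \<in># \<B>. x \<in> X#} = r) \<and>
     (\<forall>x\<in>V. \<forall>y\<in>V. x \<noteq> y \<longrightarrow> size {#X \<in># \<B>. x \<in> X \<and> y \<in> X#} = lam)"

definition incidence_matrix :: "'p list \<Rightarrow> 'p set list \<Rightarrow> int mat" where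
  "incidence_matrix ps bs =
     mat (length ps) (length bs) (\<lambda>(i, j). if ps ! i \<in> bs ! j then 1 else 0)"

definition append_cols :: "'a::zero mat \<Rightarrow> 'a mat \<Rightarrow> 'a mat" where
  "append_cols A B = four_block_mat A B (0\<^sub>m 0 (dim_col A)) (0\<^sub>m 0 (dim_col B))"

definition generated_code :: "'a::field mat \<Rightarrow> 'a vec set" where
  "generated_code A = vec_space.row_space (dim_col A) A"

definition linear_code :: "nat \<Rightarrow> 'a::field vec set \<Rightarrow> bool" where
  "linear_code N C \<longleftrightarrow> VectorSpace.subspace class_ring C (module_vec TYPE('a) N)"

definition LCD_code :: "nat \<Rightarrow> 'a::field vec set \<Rightarrow> bool" where
  "LCD_code N C \<longleftrightarrow> linear_code N C \<and> C \<inter> vec_module.orthogonal_complement N C = {0\<^sub>v N}"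

end

theory Submission
  imports Defs
begin

text \<open>
  If \<open>v = A\<^sup>T c\<close> is a codeword orthogonal to all rows of \<open>A\<close>, then \<open>A A\<^sup>T c = 0\<close>, so it suffices that
  \<open>A A\<^sup>T = R R\<^sup>T + B B\<^sup>T\<close> has trivial kernel. The design property gives \<open>B B\<^sup>T = (r - \<lambda>) I + \<lambda> J\<close>. As all
  orbits have the same length, the common row sum of each block of \<open>W\<close> is also its common column
  sum; hence, for any row \<open>x\<close> in the \<open>i\<close>-th row orbit, the entry of \<open>R R\<^sup>T\<close> at \<open>(i, k)\<close> is the sum over
  the rows \<open>x'\<close> in the \<open>k\<close>-th row orbit of the entry of \<open>W W\<^sup>T\<close> at \<open>(x, x')\<close>, and so \<open>R R\<^sup>T = m I\<close>.
  Finally, the two factors assumed to be nonzero are the eigenvalues of \<open>(r - \<lambda> + m) I + \<lambda> J\<close>.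
\<close>

section \<open>Permutation matrices as bijections of the index set\<close>

text \<open>The \<open>1\<close> of column \<open>j\<close> stands in row \<open>p j\<close>, the
  convention of \<open>perm_act\<close>; matrix products then correspond to composition in the same
  order.\<close>

definition perm_mat :: "nat \<Rightarrow> (nat \<Rightarrow> nat) \<Rightarrow> 'a::semiring_1 mat" where
  "perm_mat n p = mat n n (\<lambda>(i, j). if i = p j then 1 else 0)"

lemma perm_mat_carrier [simp]: "perm_mat n p \<in> carrier_mat n n"
  by (simp add: perm_mat_def)

lemma Bij_lessThan_less: "p \<in> Bij {..<n} \<Longrightarrow> i < n \<Longrightarrow> p i < n"
  using Bij_imp_funcset by fastforce

lemma Bij_lessThan_eq_iff: "p \<in> Bij {..<n} \<Longrightarrow> i < n \<Longrightarrow> j < n \<Longrightarrow> p i = p j \<longleftrightarrow> i = j"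
  by (auto simp: Bij_def bij_betw_def inj_on_def)

lemma Bij_lessThan_ex1: "p \<in> Bij {..<n} \<Longrightarrow> i < n \<Longrightarrow> \<exists>!j. j < n \<and> p j = i"
  by (force simp: Bij_def bij_betw_def inj_on_def)

lemma permutation_matrix_perm_mat:
  assumes "p \<in> Bij {..<n}"
  shows "permutation_matrix n (perm_mat n p :: 'a::semiring_1 mat)"
  unfolding permutation_matrix_def
proof (intro conjI allI impI)
  show "elements_mat (perm_mat n p :: 'a mat) \<subseteq> {0, 1}"
    by (auto simp: perm_mat_def elements_mat_def)
next
  fix i assume i: "i < n"
  have eq: "(perm_mat n p :: 'a mat) $$ (i, j) = 1 \<longleftrightarrow> p j = i" if "j < n" for j
    using that i by (auto simp: perm_mat_def)
  show "\<exists>!j. j < n \<and> (perm_mat n p :: 'a mat) $$ (i, j) = 1"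
    using Bij_lessThan_ex1[OF assms i] eq by metis
next
  fix j assume j: "j < n"
  have eq: "(perm_mat n p :: 'a mat) $$ (i, j) = 1 \<longleftrightarrow> i = p j" if "i < n" for i
    using that j by (auto simp: perm_mat_def)
  show "\<exists>!i. i < n \<and> (perm_mat n p :: 'a mat) $$ (i, j) = 1"
    using Bij_lessThan_less[OF assms j] eq by metis
qed simp

lemma perm_act_perm_mat:
  assumes "p \<in> Bij {..<n}"
  shows "perm_act n (perm_mat n p :: 'a::semiring_1 mat) = p"
proof
  fix j
  show "perm_act n (perm_mat n p :: 'a mat) j = p j"
  proof (cases "j < n")
    case True
    have "(THE k. k < n \<and> (perm_mat n p :: 'a mat) $$ (k, j) = 1) = p j"
      by (rule the_equality)
        (use True Bij_lessThan_less[OF assms True] in \<open>auto simp: perm_mat_def split: if_splits\<close>)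
    then show ?thesis using True by (simp add: perm_act_def)
  next
    \<comment> \<open>Members of \<open>Bij\<close> are extensional, so both sides are
      \<open>undefined\<close> outside the index range.\<close>
    case False
    then show ?thesis
      using assms by (auto simp: perm_act_def Bij_def extensional_def)
  qed
qed

text \<open>With \<open>perm_act_perm_mat\<close> this makes \<open>perm_act\<close> and
  \<open>perm_mat\<close> mutually inverse, so that matrices can be traded for index functions. The
  unique \<open>1\<close> in each column makes \<open>perm_act\<close> well defined; the unique
  \<open>1\<close> in each row makes it bijective.\<close>

lemma permutation_matrixD:
  fixes P :: "'a::semiring_1 mat"
  assumes P: "permutation_matrix n P"
  shows "perm_act n P \<in> Bij {..<n}" and "P = perm_mat n (perm_act n P)"
proof -
  let ?p = "perm_act n P"
  have ex_row: "\<exists>!j. j < n \<and> P $$ (i, j) = 1" if "i < n" for i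
    using P that by (auto simp: permutation_matrix_def)
  have ex_col: "\<exists>!i. i < n \<and> P $$ (i, j) = 1" if "j < n" for j
    using P that by (auto simp: permutation_matrix_def)
  have p: "?p j < n \<and> P $$ (?p j, j) = 1" if "j < n" for j
    using theI'[OF ex_col[OF that]] that by (simp add: perm_act_def)
  have p_iff: "P $$ (i, j) = 1 \<longleftrightarrow> i = ?p j" if "i < n" "j < n" for i j
    using p[OF that(2)] ex_col[OF that(2)] that(1) by blast
  have bij: "bij_betw ?p {..<n} {..<n}"
    unfolding bij_betw_def
  proof
    show "inj_on ?p {..<n}"
      using p ex_row by (intro inj_onI) (metis lessThan_iff)
    show "?p ` {..<n} = {..<n}"
    proof (intro equalityI subsetI)
      fix i assume "i \<in> {..<n}"
      then show "i \<in> ?p ` {..<n}" using ex_row[of i] p_iff by auto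
    qed (use p in auto)
  qed
  then show "?p \<in> Bij {..<n}"
    by (simp add: Bij_def perm_act_def)
  have "P $$ (i, j) \<in> {0, 1}" if "i < n" "j < n" for i j
  proof -
    have "P $$ (i, j) \<in> elements_mat P"
      using P that by (intro elements_matI) (auto simp: permutation_matrix_def)
    then show ?thesis using P by (auto simp: permutation_matrix_def)
  qed
  then show "P = perm_mat n ?p"
    using P p_iff by (intro eq_matI) (auto simp: perm_mat_def permutation_matrix_def)
qed

lemma perm_mat_mult:
  assumes "q \<in> Bij {..<n}"
  shows "(perm_mat n p * perm_mat n q :: 'a::semiring_1 mat) = perm_mat n (compose {..<n} p q)"
proof (rule eq_matI)
  fix i j assume "i < dim_row (perm_mat n (compose {..<n} p q) :: 'a mat)"
    and "j < dim_col (perm_mat n (compose {..<n} p q) :: 'a mat)"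
  then have ij: "i < n" "j < n" by (simp_all add: perm_mat_def)
  have "(perm_mat n p * perm_mat n q :: 'a mat) $$ (i, j)
      = (\<Sum>k<n. (if i = p k then 1 else 0) * (if k = q j then 1 else 0))"
    using ij by (simp add: perm_mat_def scalar_prod_def lessThan_atLeast0)
  also have "\<dots> = (\<Sum>k<n. if k = q j then (if i = p (q j) then 1 else 0) else 0)"
    by (rule sum.cong) auto
  also have "\<dots> = perm_mat n (compose {..<n} p q) $$ (i, j)"
    using ij Bij_lessThan_less[OF assms ij(2)] by (simp add: perm_mat_def compose_def)
  finally show "(perm_mat n p * perm_mat n q :: 'a mat) $$ (i, j)
      = perm_mat n (compose {..<n} p q) $$ (i, j)" .
qed (simp_all add: perm_mat_def)

text \<open>Reading the entry at \<open>(p i, q j)\<close> avoids inverse permutations: by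
  injectivity the left product collapses at \<open>k = i\<close> and the right one at
  \<open>l = j\<close>.\<close>

lemma perm_mat_conj_index:
  fixes M :: "'a::semiring_1 mat"
  assumes M: "M \<in> carrier_mat n n" and p: "p \<in> Bij {..<n}" and q: "q \<in> Bij {..<n}"
    and ij: "i < n" "j < n"
  shows "(perm_mat n p * M * (perm_mat n q)\<^sup>T) $$ (p i, q j) = M $$ (i, j)"
proof -
  note lt = Bij_lessThan_less[OF p ij(1)] Bij_lessThan_less[OF q ij(2)]
  have row: "(perm_mat n p * M) $$ (p i, l) = M $$ (i, l)" if l: "l < n" for l
  proof -
    have "(perm_mat n p * M) $$ (p i, l) = (\<Sum>k<n. (if p i = p k then 1 else 0) * M $$ (k, l))"
      using lt l M by (simp add: perm_mat_def scalar_prod_def lessThan_atLeast0)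
    also have "\<dots> = (\<Sum>k<n. if k = i then M $$ (i, l) else 0)"
      using Bij_lessThan_eq_iff[OF p] ij by (intro sum.cong) auto
    finally show ?thesis using ij by simp
  qed
  have "(perm_mat n p * M * (perm_mat n q)\<^sup>T) $$ (p i, q j)
      = (\<Sum>l<n. (perm_mat n p * M) $$ (p i, l) * (if q j = q l then 1 else 0))"
    using lt M by (simp add: perm_mat_def scalar_prod_def lessThan_atLeast0)
  also have "\<dots> = (\<Sum>l<n. if l = j then M $$ (i, j) else 0)"
    using Bij_lessThan_eq_iff[OF q] ij row by (intro sum.cong) auto
  finally show ?thesis using ij by simp
qed

text \<open>Automorphisms become invariance of the entries. For the converse, surjectivity of
  \<open>p\<close> and \<open>q\<close> writes every position as
  \<open>(p i', q j')\<close>.\<close>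

lemma perm_mat_conj_eq_iff:
  fixes M :: "'a::semiring_1 mat"
  assumes M: "M \<in> carrier_mat n n" and p: "p \<in> Bij {..<n}" and q: "q \<in> Bij {..<n}"
  shows "perm_mat n p * M * (perm_mat n q)\<^sup>T = M \<longleftrightarrow>
    (\<forall>i<n. \<forall>j<n. M $$ (p i, q j) = M $$ (i, j))" (is "?N = M \<longleftrightarrow> ?inv")
proof
  assume "?N = M"
  then show ?inv using perm_mat_conj_index[OF M p q] by metis
next
  assume inv: ?inv
  show "?N = M"
  proof (rule eq_matI)
    fix i j assume "i < dim_row M" "j < dim_col M"
    then obtain i' j' where "i' < n" "p i' = i" "j' < n" "q j' = j"
      using M Bij_lessThan_ex1[OF p, of i] Bij_lessThan_ex1[OF q, of j] by auto
    then show "?N $$ (i, j) = M $$ (i, j)"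
      using perm_mat_conj_index[OF M p q] inv by metis
  qed (use M in \<open>simp_all add: perm_mat_def\<close>)
qed

section \<open>The permutation automorphism group and its actions on indices\<close>

lemma mem_PAut_perm_mat_iff:
  fixes M :: "'a::semiring_1 mat"
  assumes "M \<in> carrier_mat n n" "p \<in> Bij {..<n}" "q \<in> Bij {..<n}"
  shows "(perm_mat n p, perm_mat n q) \<in> carrier (PAut n M) \<longleftrightarrow>
    (\<forall>i<n. \<forall>j<n. M $$ (p i, q j) = M $$ (i, j))"
  using assms by (simp add: PAut_def permutation_matrix_perm_mat perm_mat_conj_eq_iff)

lemma PAut_cases:
  fixes M :: "'a::semiring_1 mat"
  assumes M: "M \<in> carrier_mat n n" and g: "g \<in> carrier (PAut n M)"
  obtains p q where "g = (perm_mat n p, perm_mat n q)" "p \<in> Bij {..<n}" "q \<in> Bij {..<n}"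
    "\<And>i j. i < n \<Longrightarrow> j < n \<Longrightarrow> M $$ (p i, q j) = M $$ (i, j)"
proof -
  obtain P Q where PQ: "g = (P, Q)" "permutation_matrix n P" "permutation_matrix n Q"
    using g by (auto simp: PAut_def)
  let ?p = "perm_act n P" and ?q = "perm_act n Q"
  have g': "g = (perm_mat n ?p, perm_mat n ?q)"
    using PQ permutation_matrixD(2) by metis
  have "M $$ (?p i, ?q j) = M $$ (i, j)" if "i < n" "j < n" for i j
    using g[unfolded g'] that
    by (simp add: mem_PAut_perm_mat_iff[OF M permutation_matrixD(1)[OF PQ(2)] permutation_matrixD(1)[OF PQ(3)]])
  then show thesis
    using that[OF g'] permutation_matrixD(1) PQ by blast
qed

lemma one_mat_eq_perm_mat: "1\<^sub>m n = perm_mat n (\<lambda>x\<in>{..<n}. x)"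
  by (auto simp: perm_mat_def)

lemma group_PAut:
  fixes M :: "'a::semiring_1 mat"
  assumes M: "M \<in> carrier_mat n n"
  shows "group (PAut n M)"
proof (rule groupI)
  fix g h assume "g \<in> carrier (PAut n M)" "h \<in> carrier (PAut n M)"
  then obtain p q p' q' where
    "g = (perm_mat n p, perm_mat n q)" "h = (perm_mat n p', perm_mat n q')"
    and Bij: "p \<in> Bij {..<n}" "q \<in> Bij {..<n}" "p' \<in> Bij {..<n}" "q' \<in> Bij {..<n}"
    and inv: "\<And>i j. i < n \<Longrightarrow> j < n \<Longrightarrow> M $$ (p i, q j) = M $$ (i, j)"
      "\<And>i j. i < n \<Longrightarrow> j < n \<Longrightarrow> M $$ (p' i, q' j) = M $$ (i, j)"
    using PAut_cases[OF M] by metis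
  then have "g \<otimes>\<^bsub>PAut n M\<^esub> h = (perm_mat n (compose {..<n} p p'), perm_mat n (compose {..<n} q q'))"
    by (simp add: PAut_def perm_mat_mult)
  then show "g \<otimes>\<^bsub>PAut n M\<^esub> h \<in> carrier (PAut n M)"
    using Bij inv by (simp add: mem_PAut_perm_mat_iff M compose_Bij compose_eq Bij_lessThan_less)
next
  have "\<one>\<^bsub>PAut n M\<^esub> = (perm_mat n (\<lambda>x\<in>{..<n}. x), perm_mat n (\<lambda>x\<in>{..<n}. x))"
    by (simp add: PAut_def one_mat_eq_perm_mat)
  then show "\<one>\<^bsub>PAut n M\<^esub> \<in> carrier (PAut n M)"
    by (simp add: mem_PAut_perm_mat_iff M id_Bij)
next
  fix g h k assume "g \<in> carrier (PAut n M)" "h \<in> carrier (PAut n M)" "k \<in> carrier (PAut n M)"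
  then show "g \<otimes>\<^bsub>PAut n M\<^esub> h \<otimes>\<^bsub>PAut n M\<^esub> k = g \<otimes>\<^bsub>PAut n M\<^esub> (h \<otimes>\<^bsub>PAut n M\<^esub> k)"
    by (auto simp: PAut_def permutation_matrix_def intro!: assoc_mult_mat)
next
  fix g assume "g \<in> carrier (PAut n M)"
  then show "\<one>\<^bsub>PAut n M\<^esub> \<otimes>\<^bsub>PAut n M\<^esub> g = g"
    by (auto simp: PAut_def permutation_matrix_def)
next
  fix g assume "g \<in> carrier (PAut n M)"
  then obtain p q where g: "g = (perm_mat n p, perm_mat n q)"
    and Bij: "p \<in> Bij {..<n}" "q \<in> Bij {..<n}"
    and inv: "\<And>i j. i < n \<Longrightarrow> j < n \<Longrightarrow> M $$ (p i, q j) = M $$ (i, j)"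
    using PAut_cases[OF M] by metis
  \<comment> \<open>The inverses are restricted to the index range so that they are extensional and
    lie in \<open>Bij\<close> again.\<close>
  let ?p = "\<lambda>x\<in>{..<n}. inv_into {..<n} p x" and ?q = "\<lambda>x\<in>{..<n}. inv_into {..<n} q x"
  have Bij': "?p \<in> Bij {..<n}" "?q \<in> Bij {..<n}"
    using Bij by (auto intro: restrict_inv_into_Bij)
  have "M $$ (?p i, ?q j) = M $$ (i, j)" if "i < n" "j < n" for i j
  proof -
    have "p (?p i) = i" "q (?q j) = j"
      using that Bij by (auto simp: Bij_def bij_betw_def intro!: f_inv_into_f)
    then show ?thesis
      using inv[OF Bij_lessThan_less[OF Bij'(1) that(1)] Bij_lessThan_less[OF Bij'(2) that(2)]] by simp
  qed
  then have "(perm_mat n ?p, perm_mat n ?q) \<in> carrier (PAut n M)"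
    using mem_PAut_perm_mat_iff[OF M Bij'] by blast
  moreover have "(perm_mat n ?p, perm_mat n ?q) \<otimes>\<^bsub>PAut n M\<^esub> g = \<one>\<^bsub>PAut n M\<^esub>"
    using Bij by (simp add: g PAut_def perm_mat_mult Bij_compose_restrict_eq one_mat_eq_perm_mat)
  ultimately show "\<exists>h\<in>carrier (PAut n M). h \<otimes>\<^bsub>PAut n M\<^esub> g = \<one>\<^bsub>PAut n M\<^esub>"
    by blast
qed

text \<open>\<open>perm_act\<close> turns products of permutation matrices into compositions, the
  multiplication of \<open>BijGroup\<close>; each component of a pair therefore gives a
  homomorphism.\<close>

lemma group_action_PAut:
  fixes M :: "'a::semiring_1 mat"
  assumes M: "M \<in> carrier_mat n n" and G: "subgroup G (PAut n M)"
  shows group_action_PAut_rows: "group_action (PAut n M\<lparr>carrier := G\<rparr>) {..<n} (\<lambda>(P, Q). perm_act n P)"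
    and group_action_PAut_cols: "group_action (PAut n M\<lparr>carrier := G\<rparr>) {..<n} (\<lambda>(P, Q). perm_act n Q)"
proof -
  have grp: "group (PAut n M\<lparr>carrier := G\<rparr>)" "group (BijGroup {..<n})"
    using subgroup.subgroup_is_group[OF G group_PAut[OF M]] group_BijGroup by auto
  have cases: "\<exists>p q. g = (perm_mat n p, perm_mat n q) \<and> p \<in> Bij {..<n} \<and> q \<in> Bij {..<n}"
    if "g \<in> G" for g
    using PAut_cases[OF M subgroup.mem_carrier[OF G that]] by metis
  have "(\<lambda>(P, Q). perm_act n P) \<in> hom (PAut n M\<lparr>carrier := G\<rparr>) (BijGroup {..<n})"
    "(\<lambda>(P, Q). perm_act n Q) \<in> hom (PAut n M\<lparr>carrier := G\<rparr>) (BijGroup {..<n})"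
    by (auto simp: hom_def BijGroup_def PAut_def perm_act_perm_mat
        perm_mat_mult compose_Bij dest!: cases)
  with grp show "group_action (PAut n M\<lparr>carrier := G\<rparr>) {..<n} (\<lambda>(P, Q). perm_act n P)"
    and "group_action (PAut n M\<lparr>carrier := G\<rparr>) {..<n} (\<lambda>(P, Q). perm_act n Q)"
    by (auto intro!: group_action.intro group_hom.intro group_hom_axioms.intro)
qed

lemma PAut_index_invariant:
  fixes M :: "'a::semiring_1 mat"
  assumes "M \<in> carrier_mat n n" "(P, Q) \<in> carrier (PAut n M)" "i < n" "j < n"
  shows "M $$ (perm_act n P i, perm_act n Q j) = M $$ (i, j)"
  using PAut_cases[OF assms(1,2)] assms(3,4) by (metis perm_act_perm_mat prod.inject)

section \<open>Orbit sums of invariant functions\<close>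

text \<open>A point \<open>\<phi> h x\<close> of the orbit is the image under \<open>g\<close> of
  \<open>\<phi> (inv g \<otimes> h) x\<close>, and injectivity is inherited from the whole set. This
  allows sums over an orbit to be reindexed by a group element.\<close>

lemma (in group_action) bij_betw_orbit:
  assumes g: "g \<in> carrier G" and C: "C \<in> orbits G E \<phi>"
  shows "bij_betw (\<phi> g) C C"
proof -
  interpret group G
    using group_hom group_hom.axioms(1) by auto
  obtain x where x: "x \<in> E" "C = orbit G \<phi> x"
    using C by (auto simp: orbits_def)
  have "\<phi> g ` C = C"
  proof (intro equalityI subsetI)
    fix y assume "y \<in> \<phi> g ` C"
    then obtain h where h: "h \<in> carrier G" "y = \<phi> g (\<phi> h x)"
      using x by (auto simp: orbit_def)
    then have "y = \<phi> (g \<otimes> h) x"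
      using g x composition_rule by simp
    then show "y \<in> C"
      using g h x by (auto simp: orbit_def)
  next
    fix y assume "y \<in> C"
    then obtain h where h: "h \<in> carrier G" "y = \<phi> h x"
      using x by (auto simp: orbit_def)
    have "h = g \<otimes> (inv g \<otimes> h)"
      using g h by (simp add: m_assoc[symmetric])
    then have "y = \<phi> g (\<phi> (inv g \<otimes> h) x)"
      using composition_rule[of x g "inv g \<otimes> h"] g h x by simp
    moreover have "\<phi> (inv g \<otimes> h) x \<in> C"
      using g h x by (auto simp: orbit_def)
    ultimately show "y \<in> \<phi> g ` C"
      by blast
  qed
  moreover have "inj_on (\<phi> g) C"
    using inj_prop[OF g] C orbits_coverture by (blast intro: inj_on_subset)
  ultimately show ?thesis
    by (simp add: bij_betw_def)
qed

text \<open>If \<open>g\<close> carries \<open>x0\<close> to \<open>z\<close>, reindexing the sum at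
  \<open>z\<close> by \<open>\<psi> g\<close> turns it into the sum at \<open>x0\<close>. The two
  actions are kept abstract so that rows and columns can exchange roles.\<close>

lemma orbit_sum_invariant:
  fixes f :: "'b \<Rightarrow> 'c \<Rightarrow> 'd::comm_monoid_add"
  assumes \<phi>: "group_action H E \<phi>" and \<psi>: "group_action H F \<psi>"
    and inv: "\<And>g x y. g \<in> carrier H \<Longrightarrow> x \<in> E \<Longrightarrow> y \<in> F \<Longrightarrow> f (\<phi> g x) (\<psi> g y) = f x y"
    and X: "X \<in> orbits H E \<phi>" and Y: "Y \<in> orbits H F \<psi>" and x: "x \<in> X" "x' \<in> X"
  shows "(\<Sum>y\<in>Y. f x y) = (\<Sum>y\<in>Y. f x' y)"
proof -
  have Y_sub: "Y \<subseteq> F"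
    using Y group_action.orbits_coverture[OF \<psi>] by blast
  obtain x0 where x0: "x0 \<in> E" "X = orbit H \<phi> x0"
    using X by (auto simp: orbits_def)
  have "(\<Sum>y\<in>Y. f z y) = (\<Sum>y\<in>Y. f x0 y)" if z: "z \<in> X" for z
  proof -
    obtain g where g: "g \<in> carrier H" "z = \<phi> g x0"
      using z x0 by (auto simp: orbit_def)
    have "(\<Sum>y\<in>Y. f z y) = (\<Sum>y\<in>Y. f z (\<psi> g y))"
      using sum.reindex_bij_betw[OF group_action.bij_betw_orbit[OF \<psi> g(1) Y]] by metis
    also have "\<dots> = (\<Sum>y\<in>Y. f x0 y)"
      using inv g x0 Y_sub by (intro sum.cong) auto
    finally show ?thesis .
  qed
  then show ?thesis
    using x by simp
qed

section \<open>The row orbit matrix and its Gram matrix\<close>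

text \<open>The value described by \<open>THE\<close> exists because the row sums are constant on
  the orbit, and it is unique because the orbit contains \<open>x\<close>.\<close>

lemma row_orbit_matrix_index:
  fixes M :: "'a::semiring_1 mat"
  assumes M: "M \<in> carrier_mat n n" and G: "subgroup G (PAut n M)"
    and Rs: "set Rs = row_orbits n M G" and Cs: "set Cs = col_orbits n M G"
    and i: "i < length Rs" and j: "j < length Cs" and x: "x \<in> Rs ! i"
  shows "row_orbit_matrix M Rs Cs $$ (i, j) = (\<Sum>y\<in>Cs ! j. M $$ (x, y))"
proof -
  have row: "(\<Sum>y\<in>Cs ! j. M $$ (x', y)) = (\<Sum>y\<in>Cs ! j. M $$ (x, y))" if "x' \<in> Rs ! i" for x'
  proof (rule orbit_sum_invariant[OF group_action_PAut[OF M G]])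
    show "Rs ! i \<in> orbits (PAut n M\<lparr>carrier := G\<rparr>) {..<n} (\<lambda>(P, Q). perm_act n P)"
      "Cs ! j \<in> orbits (PAut n M\<lparr>carrier := G\<rparr>) {..<n} (\<lambda>(P, Q). perm_act n Q)"
      using Rs Cs i j nth_mem unfolding row_orbits_def col_orbits_def by blast+
  qed (use PAut_index_invariant[OF M subgroup.mem_carrier[OF G]] that x in auto)
  have "(THE s. \<forall>x'\<in>Rs ! i. (\<Sum>y\<in>Cs ! j. M $$ (x', y)) = s) = (\<Sum>y\<in>Cs ! j. M $$ (x, y))"
  proof (rule the_equality)
    show "\<forall>x'\<in>Rs ! i. (\<Sum>y\<in>Cs ! j. M $$ (x', y)) = (\<Sum>y\<in>Cs ! j. M $$ (x, y))"
      using row by blast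
  next
    fix s assume s: "\<forall>x'\<in>Rs ! i. (\<Sum>y\<in>Cs ! j. M $$ (x', y)) = s"
    show "s = (\<Sum>y\<in>Cs ! j. M $$ (x, y))"
      by (rule bspec[OF s x, symmetric])
  qed
  then show ?thesis
    using i j by (simp add: row_orbit_matrix_def)
qed

text \<open>Double counting of the block sum; the lengths of the two orbits cancel because they agree.\<close>

lemma row_orbit_matrix_index_col:
  fixes M :: "'a::{idom, ring_char_0} mat"
  assumes M: "M \<in> carrier_mat n n" and G: "subgroup G (PAut n M)"
    and Rs: "set Rs = row_orbits n M G" and Cs: "set Cs = col_orbits n M G"
    and card: "\<forall>X \<in> row_orbits n M G \<union> col_orbits n M G. card X = w"
    and i: "i < length Rs" and j: "j < length Cs" and y: "y \<in> Cs ! j"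
  shows "row_orbit_matrix M Rs Cs $$ (i, j) = (\<Sum>x\<in>Rs ! i. M $$ (x, y))"
proof -
  have ij: "Rs ! i \<in> row_orbits n M G" "Cs ! j \<in> col_orbits n M G"
    using Rs Cs i j nth_mem by blast+
  \<comment> \<open>The final cancellation needs \<open>w\<close> nonzero: the orbit contains
    \<open>y\<close>, and finiteness rules out the default value 0 of \<open>card\<close>.\<close>
  have "finite (Cs ! j)"
    using ij group_action.orbits_coverture[OF group_action_PAut_cols[OF M G]]
    by (metis Sup_upper col_orbits_def finite_lessThan finite_subset)
  moreover have "card (Cs ! j) = w"
    using card ij by blast
  ultimately have w: "w \<noteq> 0"
    using y card_0_eq by blast
  \<comment> \<open>Here the actions change places: the column action moves \<open>y\<close>, and
    the row orbit is the range of summation.\<close>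
  have col: "(\<Sum>x\<in>Rs ! i. M $$ (x, y')) = (\<Sum>x\<in>Rs ! i. M $$ (x, y))" if "y' \<in> Cs ! j" for y'
    by (rule orbit_sum_invariant[OF group_action_PAut(2,1)[OF M G], where X = "Cs ! j"])
      (use PAut_index_invariant[OF M subgroup.mem_carrier[OF G]] that y ij
        in \<open>auto simp: row_orbits_def col_orbits_def\<close>)
  have "of_nat w * row_orbit_matrix M Rs Cs $$ (i, j) = (\<Sum>x\<in>Rs ! i. row_orbit_matrix M Rs Cs $$ (i, j))"
    using card ij by simp
  also have "\<dots> = (\<Sum>x\<in>Rs ! i. \<Sum>y\<in>Cs ! j. M $$ (x, y))"
    by (intro sum.cong refl row_orbit_matrix_index[OF M G Rs Cs i j])
  also have "\<dots> = (\<Sum>y\<in>Cs ! j. \<Sum>x\<in>Rs ! i. M $$ (x, y))"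
    by (rule sum.swap)
  also have "\<dots> = of_nat w * (\<Sum>x\<in>Rs ! i. M $$ (x, y))"
  proof -
    have "(\<Sum>y'\<in>Cs ! j. \<Sum>x\<in>Rs ! i. M $$ (x, y')) = (\<Sum>y'\<in>Cs ! j. \<Sum>x\<in>Rs ! i. M $$ (x, y))"
      by (intro sum.cong refl col)
    then show ?thesis
      using card ij by simp
  qed
  finally show ?thesis
    using w by simp
qed

text \<open>The two factors are expanded differently: the first along one fixed row \<open>x\<close>
  of orbit \<open>i\<close>, the second down column \<open>y\<close> over orbit \<open>k\<close>,
  for each \<open>y\<close> in turn. The sums over the column orbits then join into full inner
  products of rows of \<open>M\<close>.\<close>

lemma row_orbit_matrix_gram:
  fixes M :: "'a::{idom, ring_char_0} mat"
  assumes M: "M \<in> carrier_mat n n" and G: "subgroup G (PAut n M)"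
    and Rs: "distinct Rs" "set Rs = row_orbits n M G"
    and Cs: "distinct Cs" "set Cs = col_orbits n M G"
    and card: "\<forall>X \<in> row_orbits n M G \<union> col_orbits n M G. card X = w"
    and gram: "\<And>x x'. x < n \<Longrightarrow> x' < n \<Longrightarrow>
      (\<Sum>y<n. M $$ (x, y) * M $$ (x', y)) = (if x = x' then a else 0)"
    and ik: "i < length Rs" "k < length Rs"
  defines "R \<equiv> row_orbit_matrix M Rs Cs"
  shows "(\<Sum>j<length Cs. R $$ (i, j) * R $$ (k, j)) = (if i = k then a else 0)"
proof -
  interpret rows: group_action "PAut n M\<lparr>carrier := G\<rparr>" "{..<n}" "\<lambda>(P, Q). perm_act n P"
    using M G by (rule group_action_PAut)
  interpret cols: group_action "PAut n M\<lparr>carrier := G\<rparr>" "{..<n}" "\<lambda>(P, Q). perm_act n Q"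
    using M G by (rule group_action_PAut)
  have orb: "Rs ! i \<in> row_orbits n M G" "Rs ! k \<in> row_orbits n M G"
    using Rs ik nth_mem by blast+
  then have sub: "Rs ! i \<subseteq> {..<n}" "Rs ! k \<subseteq> {..<n}"
    using rows.orbits_coverture by (auto simp: row_orbits_def)
  obtain x where x: "x \<in> Rs ! i"
    using orb(1) rows.orbit_refl by (auto simp: row_orbits_def orbits_def)
  \<comment> \<open>Orbits that share a point coincide, and distinctness of \<open>Rs\<close> turns
    equal orbits into equal indices.\<close>
  have x_in_k: "x \<in> Rs ! k \<longleftrightarrow> i = k"
  proof
    assume "x \<in> Rs ! k"
    then have "Rs ! i = Rs ! k"
      using rows.disjoint_union[of "Rs ! i" "Rs ! k"] orb x by (auto simp: row_orbits_def)
    then show "i = k"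
      using Rs(1) ik by (simp add: nth_eq_iff_index_eq)
  qed (use x in simp)
  have "(\<Sum>j<length Cs. R $$ (i, j) * R $$ (k, j))
      = (\<Sum>j<length Cs. \<Sum>y\<in>Cs ! j. M $$ (x, y) * (\<Sum>x'\<in>Rs ! k. M $$ (x', y)))"
  proof (rule sum.cong)
    fix j assume "j \<in> {..<length Cs}"
    then have j: "j < length Cs" by simp
    have "R $$ (i, j) * R $$ (k, j) = (\<Sum>y\<in>Cs ! j. M $$ (x, y) * R $$ (k, j))"
      unfolding R_def row_orbit_matrix_index[OF M G Rs(2) Cs(2) ik(1) j x]
      by (rule sum_distrib_right)
    then show "R $$ (i, j) * R $$ (k, j) = (\<Sum>y\<in>Cs ! j. M $$ (x, y) * (\<Sum>x'\<in>Rs ! k. M $$ (x', y)))"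
      unfolding R_def
      using row_orbit_matrix_index_col[OF M G Rs(2) Cs(2) card ik(2) j] by simp
  qed simp
  also have "\<dots> = (\<Sum>C\<in>col_orbits n M G. \<Sum>y\<in>C. M $$ (x, y) * (\<Sum>x'\<in>Rs ! k. M $$ (x', y)))"
    by (rule sum.reindex_bij_betw[OF bij_betw_nth[OF Cs(1) refl Cs(2)[symmetric]]])
  \<comment> \<open>The column orbits partition the set of column indices.\<close>
  also have "\<dots> = (\<Sum>y<n. M $$ (x, y) * (\<Sum>x'\<in>Rs ! k. M $$ (x', y)))"
    unfolding col_orbits_def by (rule cols.disjoint_sum) simp
  also have "\<dots> = (\<Sum>x'\<in>Rs ! k. \<Sum>y<n. M $$ (x, y) * M $$ (x', y))"
    by (simp add: sum_distrib_left) (rule sum.swap)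
  also have "\<dots> = (\<Sum>x'\<in>Rs ! k. if x = x' then a else 0)"
    using sub x by (intro sum.cong) (auto simp: subset_iff gram)
  also have "\<dots> = (if i = k then a else 0)"
    using x_in_k finite_subset[OF sub(2)] by simp
  finally show ?thesis .
qed

section \<open>Gram matrices of the weighing matrix and of the design\<close>

text \<open>The defining identity lives over the complex numbers; injectivity of
  \<open>of_int\<close> brings it back to the integers, from where it can be mapped into any
  field.\<close>

lemma weighing_matrix_gram:
  assumes W: "weighing_matrix n m W" and x: "x < n" "x' < n"
  shows "(\<Sum>y<n. W $$ (x, y) * W $$ (x', y)) = (if x = x' then int m else 0)"
proof -
  let ?W = "map_mat complex_of_int W"
  have C: "W \<in> carrier_mat n n"
    using W by (simp add: weighing_matrix_def)
  have "?W * ?W\<^sup>T = of_nat m \<cdot>\<^sub>m 1\<^sub>m n"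
    using W by (simp add: weighing_matrix_def Let_def)
  then have "(?W * ?W\<^sup>T) $$ (x, x') = complex_of_int (if x = x' then int m else 0)"
    using x by simp
  moreover have "(?W * ?W\<^sup>T) $$ (x, x') = complex_of_int (\<Sum>y<n. W $$ (x, y) * W $$ (x', y))"
    using C x by (simp add: scalar_prod_def lessThan_atLeast0)
  ultimately show ?thesis
    by (simp only: of_int_eq_iff)
qed

text \<open>Each product is the indicator of a block containing both points. Counting list positions
  counts repeated blocks with multiplicity, and distinctness of \<open>ps\<close> makes different
  indices different points.\<close>

lemma incidence_matrix_gram:
  assumes des: "r_lambda_design V (mset bs) r lam"
    and ps: "distinct ps" "set ps = V" and ik: "i < length ps" "k < length ps"
  defines "B \<equiv> incidence_matrix ps bs"
  shows "(\<Sum>j<length bs. B $$ (i, j) * B $$ (k, j)) = (if i = k then int r else int lam)"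
proof -
  have "(\<Sum>j<length bs. B $$ (i, j) * B $$ (k, j))
      = (\<Sum>j<length bs. if ps ! i \<in> bs ! j \<and> ps ! k \<in> bs ! j then 1 else 0)"
    using ik by (intro sum.cong) (auto simp: B_def incidence_matrix_def)
  also have "\<dots> = int (card {j. j < length bs \<and> ps ! i \<in> bs ! j \<and> ps ! k \<in> bs ! j})"
    by (simp add: sum.If_cases Int_def)
  also have "\<dots> = int (size {#X \<in># mset bs. ps ! i \<in> X \<and> ps ! k \<in> X#})"
    by (simp flip: mset_filter add: length_filter_conv_card)
  also have "\<dots> = (if i = k then int r else int lam)"
    using des ps ik nth_mem[of i ps] nth_mem[of k ps]
    by (auto simp: r_lambda_design_def nth_eq_iff_index_eq)
  finally show ?thesis .
qed

section \<open>Trivial kernels and the LCD property\<close>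

lemma LCD_code_generated_codeI:
  fixes A :: "'a::field mat"
  assumes A: "A \<in> carrier_mat k N"
    and ker: "\<And>c. c \<in> carrier_vec k \<Longrightarrow> A *\<^sub>v (A\<^sup>T *\<^sub>v c) = 0\<^sub>v k \<Longrightarrow> c = 0\<^sub>v k"
  shows "LCD_code N (generated_code A)"
proof -
  interpret vec_space "TYPE('a)" N .
  have dim: "dim_col A = N"
    using A by simp
  have rows: "set (rows A) \<subseteq> carrier_vec N"
    using A rows_carrier[of A] by simp
  have lin: "linear_code N (generated_code A)"
    unfolding linear_code_def generated_code_def dim row_space_def
    using span_is_subspace rows by simp
  have code: "generated_code A = {v. \<exists>c\<in>carrier_vec k. v = A\<^sup>T *\<^sub>v c}"
    unfolding generated_code_def dim row_space_eq[OF A] using A by auto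
  have "v = 0\<^sub>v N" if v_code: "v \<in> generated_code A" and orth: "v \<in> orthogonal_complement (generated_code A)" for v
  proof -
    obtain c where c: "c \<in> carrier_vec k" "v = A\<^sup>T *\<^sub>v c"
      using v_code code by auto
    have v: "v \<in> carrier_vec N"
      using A c by auto
    have "A *\<^sub>v v = 0\<^sub>v k"
    proof (rule eq_vecI)
      fix i assume "i < dim_vec (0\<^sub>v k :: 'a vec)"
      then have i: "i < k" by simp
      \<comment> \<open>The rows are themselves codewords, so orthogonality to the code makes every
        entry of \<open>A *\<^sub>v v\<close> vanish.\<close>
      have "row A i \<in> generated_code A"
        unfolding generated_code_def dim row_space_def
        using A i rows by (intro subsetD[OF in_own_span]) (auto simp: rows_def)
      then have "v \<bullet> row A i = 0"
        using orth by (simp add: orthogonal_complement_def)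
      then show "(A *\<^sub>v v) $ i = 0\<^sub>v k $ i"
        using A i v comm_scalar_prod[of v N "row A i"] by auto
    qed (use A in simp)
    then have "c = 0\<^sub>v k"
      using ker c by simp
    then show ?thesis
      using A c by (intro eq_vecI) auto
  qed
  moreover have "0\<^sub>v N \<in> generated_code A"
    unfolding generated_code_def dim row_space_def by (rule span_zero)
  moreover have "generated_code A \<subseteq> carrier_vec N"
    using A code by auto
  then have "0\<^sub>v N \<in> orthogonal_complement (generated_code A)"
    by (auto simp: orthogonal_complement_def)
  ultimately show ?thesis
    using lin unfolding LCD_code_def by blast
qed

text \<open>Adding all \<open>t\<close> equations gives \<open>(a + of_nat t * b) * S = 0\<close>
  for the sum \<open>S\<close> of the unknowns; once \<open>S = 0\<close>, each equation reads
  \<open>a * c i = 0\<close>. There is no division by \<open>t\<close>, so the argument also covers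
  a characteristic dividing \<open>t\<close>.\<close>

lemma scalar_plus_constant_kernel:
  fixes a b :: "'a::field"
  assumes a: "a \<noteq> 0" and ab: "a + of_nat t * b \<noteq> 0"
    and zero: "\<And>i. i < t \<Longrightarrow> (\<Sum>k<t. (if i = k then a + b else b) * c k) = 0"
    and i: "i < t"
  shows "c i = 0"
proof -
  define S where "S = (\<Sum>k<t. c k)"
  have eq: "a * c i + b * S = 0" if i: "i < t" for i
  proof -
    have "(\<Sum>k<t. (if i = k then a + b else b) * c k)
        = (\<Sum>k<t. (if i = k then a * c k else 0) + b * c k)"
      by (intro sum.cong) (auto simp: algebra_simps)
    also have "\<dots> = a * c i + b * S"
      using i by (simp add: sum.distrib S_def sum_distrib_left)
    finally show ?thesis
      using zero[OF i] by simp
  qed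
  have "(a + of_nat t * b) * S = (\<Sum>k<t. a * c k + b * S)"
    by (simp add: sum.distrib S_def algebra_simps sum_distrib_left)
  also have "\<dots> = 0"
    using eq by simp
  finally have "S = 0"
    using ab by simp
  then show ?thesis
    using eq[OF i] a by simp
qed

section \<open>The code generated by the orbit matrix and the incidence matrix\<close>

theorem theorem4p6:
  fixes n m t w r lam b :: nat
    and W R B :: "int mat"
    and G :: "(int mat \<times> int mat) set"
    and Rs Cs :: "nat set list"
    and V :: "'p set" and \<B> :: "'p set multiset"
    and ps :: "'p list" and bs :: "'p set list"
    and A :: "'q::{finite, field} mat"
  assumes "weighing_matrix n m W"
    and "subgroup G (PAut n W)"
    and "distinct Rs" and "set Rs = row_orbits n W G" and "length Rs = t"
    and "distinct Cs" and "set Cs = col_orbits n W G" and "length Cs = t"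
    and "\<forall>X \<in> row_orbits n W G \<union> col_orbits n W G. card X = w"
    and "R = row_orbit_matrix W Rs Cs"
    and "r_lambda_design V \<B> r lam"
    and "distinct ps" and "set ps = V" and "length ps = t"
    and "mset bs = \<B>" and "length bs = b"
    and "B = incidence_matrix ps bs"
    and "(of_nat r + (of_nat t - 1) * of_nat lam + of_nat m :: 'q) \<noteq> 0"
    and "(of_nat r - of_nat lam + of_nat m :: 'q) \<noteq> 0"
    and "A = map_mat of_int (append_cols R B)"
  shows "LCD_code (t + b) (generated_code A)"
proof (rule LCD_code_generated_codeI)
  note [simp] = \<open>length Rs = t\<close> \<open>length Cs = t\<close> \<open>length ps = t\<close> \<open>length bs = b\<close>
  have W: "W \<in> carrier_mat n n"
    using assms(1) by (simp add: weighing_matrix_def)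
  have R: "R \<in> carrier_mat t t" and B: "B \<in> carrier_mat t b"
    using assms by (simp_all add: row_orbit_matrix_def incidence_matrix_def)
  show A: "A \<in> carrier_mat t (t + b)"
    using assms(20) R B by (auto simp: append_cols_def)
  have A_left: "A $$ (i, j) = of_int (R $$ (i, j))" if "i < t" "j < t" for i j
    using that assms(20) R B by (simp add: append_cols_def)
  have A_right: "A $$ (i, t + j) = of_int (B $$ (i, j))" if "i < t" "j < b" for i j
    using that assms(20) R B by (simp add: append_cols_def)
  let ?a = "of_nat r - of_nat lam + of_nat m :: 'q" and ?b = "of_nat lam :: 'q"
  have gram: "(\<Sum>j<t + b. A $$ (i, j) * A $$ (k, j)) = (if i = k then ?a + ?b else ?b)"
    if ik: "i < t" "k < t" for i k
  proof -
    have split: "(\<Sum>j<t + b. f j) = (\<Sum>j<t. f j) + (\<Sum>j<b. f (t + j))" for f :: "nat \<Rightarrow> 'q"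
      by (induction b) (simp_all add: add.assoc)
    \<comment> \<open>Both Gram entries are evaluated over the integers before \<open>of_int\<close>
      is applied, since cancelling the orbit length could fail in positive characteristic.\<close>
    have "(\<Sum>j<t + b. A $$ (i, j) * A $$ (k, j))
        = of_int ((\<Sum>j<t. R $$ (i, j) * R $$ (k, j)) + (\<Sum>j<b. B $$ (i, j) * B $$ (k, j)))"
      using ik by (simp add: split A_left A_right)
    also have "(\<Sum>j<t. R $$ (i, j) * R $$ (k, j)) = (if i = k then int m else 0)"
      using row_orbit_matrix_gram[OF W assms(2-4,6,7,9) weighing_matrix_gram[OF assms(1)], of i k] ik
      by (simp add: assms(10))
    also have "(\<Sum>j<b. B $$ (i, j) * B $$ (k, j)) = (if i = k then int r else int lam)"
      using incidence_matrix_gram[of V bs r lam ps i k] assms(11-17) ik by simp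
    finally show ?thesis
      by simp
  qed
  fix c :: "'q vec"
  assume c: "c \<in> carrier_vec t" and ker: "A *\<^sub>v (A\<^sup>T *\<^sub>v c) = 0\<^sub>v t"
  \<comment> \<open>Entry \<open>i\<close> of the kernel equation, with the order of summation
    exchanged so that the Gram entries become the coefficients of \<open>c\<close>.\<close>
  have "(\<Sum>k<t. (if i = k then ?a + ?b else ?b) * c $ k) = 0" if i: "i < t" for i
  proof -
    have "(\<Sum>k<t. (if i = k then ?a + ?b else ?b) * c $ k)
        = (\<Sum>k<t. \<Sum>j<t + b. A $$ (i, j) * A $$ (k, j) * c $ k)"
      using gram i by (simp flip: sum_distrib_right)
    also have "\<dots> = (\<Sum>j<t + b. A $$ (i, j) * (\<Sum>k<t. A $$ (k, j) * c $ k))"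
      by (subst sum.swap) (simp add: sum_distrib_left mult.assoc)
    also have "\<dots> = (A *\<^sub>v (A\<^sup>T *\<^sub>v c)) $ i"
      using A c i by (simp add: scalar_prod_def lessThan_atLeast0)
    finally show ?thesis
      using ker i by simp
  qed
  \<comment> \<open>This is the first nonvanishing assumption rearranged; its
    \<open>of_nat t - 1\<close> is a subtraction in the field, so \<open>t = 0\<close> causes no
    truncation.\<close>
  moreover have "?a + of_nat t * ?b \<noteq> 0"
    using assms(18) by (simp add: algebra_simps)
  ultimately have "c $ i = 0" if "i < t" for i
    using scalar_plus_constant_kernel[OF assms(19), of t ?b "\<lambda>k. c $ k"] that by blast
  then show "c = 0\<^sub>v t"
    using c by auto
qed

end
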